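(* For a determinantal $m\in\mathbb{Z}^r$ and every $k\in\{1,\dots,r\}$, $$\max\{-d_k,-l_k\}\le m_k\le d_k(n+1)-1+\min\{d_k-l_k,0\}.$$
   Context: Let $r\ge 1$ and let $l=(l_1,\dots,l_r)$, $d=(d_1,\dots,d_r)$ be vectors of positive integers; put $n=\sum_{k=1}^r l_k$. Let $X=\mathbb{P}^{l_1}\times\cdots\times\mathbb{P}^{l_r}$ over an algebraically closed field of characteristic zero. For $a\in\mathbb{Z}^r$, $H^q(X,a)$ denotes the $q$-th cohomology of the sheaf $\mathcal{O}_X(a_1,\dots,a_r)$. By the Künneth and Bott formulae, $H^q(X,a)=\bigoplus\bigotimes_{k}H^{j_k}(\mathbb{P}^{l_k},a_k)$ (sum over $j_k\in\{0,l_k\}$ with $\sum_k j_k=q$), where $H^0(\mathbb{P}^{l_k},a_k)\ne0\iff a_k\ge0$ and $H^{l_k}(\mathbb{P}^{l_k},a_k)\neq0\iff a_k<-l_k$. For a degree vector $m\in\mathbb{Z}^r$ and $\nu\in\mathbb{Z}$, the $\nu$-th term of the Weyman complex is $K_\nu(m)=\bigoplus_{p=0}^{n+1}H^{p-\nu}(X,m-pd)^{\binom{n+1}{p}}$. The vector $m$ is called determinantal if the complex has just the two terms $K_1(m)\to K_0(m)$, i.e. $K_\nu(m)=0$ for all $\nu\notin\{0,1\}$; by a result of Weyman and Zelevinsky this is equivalent to $K_{-1}(m)=K_2(m)=0$. *)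

theory Defs
  imports "HOL-Algebra.Product_Groups" "HOL-Computational_Algebra.Polynomial" "HOL-Library.Poly_Mapping"
begin

text \<open>
  Throughout, \<open>X\<close> is the product of the projective spaces \<open>P^(l 1), ..., P^(l r)\<close> over the
  field \<open>'k\<close>; \<open>l\<close>, \<open>d\<close>, \<open>m\<close>, \<open>a\<close> are functions of which only the values on \<open>{1..r}\<close> matter.
  The homogeneous coordinate \<open>x_j\<close>, \<open>0 \<le> j \<le> l k\<close>, of the \<open>k\<close>-th factor is indexed by the
  pair \<open>(k, j)\<close>.
\<close>

definition coords :: "nat \<Rightarrow> (nat \<Rightarrow> nat) \<Rightarrow> (nat \<times> nat) set" where
  "coords r l = (SIGMA k:{1..r}. {0..l k})"

text \<open>Laurent polynomials in the coordinates: the group algebra of the exponent group.\<close>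

type_synonym 'k laurent = "((nat \<times> nat) \<Rightarrow>\<^sub>0 int) \<Rightarrow>\<^sub>0 'k"

text \<open>
  The standard affine charts of \<open>X\<close> are indexed by the functions \<open>s\<close> choosing one coordinate
  \<open>(k, s k)\<close> in each factor; the chart \<open>U s\<close> is the locus where all chosen coordinates are nonzero.
\<close>

definition charts :: "nat \<Rightarrow> (nat \<Rightarrow> nat) \<Rightarrow> (nat \<Rightarrow> nat) set" where
  "charts r l = (\<Pi>\<^sub>E k\<in>{1..r}. {0..l k})"

text \<open>
  The sections of \<open>O_X(a)\<close> over the intersection of the charts in \<open>S\<close>: the part of multidegree
  \<open>a\<close> of the localization of the Cox ring \<open>k[x_(k,j)]\<close> at all coordinates that are inverted on
  some chart in \<open>S\<close>.  All these groups sit inside the ring of Laurent polynomials, and the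
  restriction maps are the inclusions.
\<close>

definition sections ::
  "nat \<Rightarrow> (nat \<Rightarrow> nat) \<Rightarrow> (nat \<Rightarrow> int) \<Rightarrow> (nat \<Rightarrow> nat) set \<Rightarrow> 'k::field laurent set" where
  "sections r l a S =
     {f. \<forall>e \<in> Poly_Mapping.keys f.
           Poly_Mapping.keys e \<subseteq> coords r l \<and>
           (\<forall>k\<in>{1..r}. (\<Sum>j = 0..l k. Poly_Mapping.lookup e (k, j)) = a k) \<and>
           (\<forall>(k, j) \<in> coords r l. Poly_Mapping.lookup e (k, j) < 0 \<longrightarrow> (\<exists>s\<in>S. s k = j))}"

definition section_group ::
  "nat \<Rightarrow> (nat \<Rightarrow> nat) \<Rightarrow> (nat \<Rightarrow> int) \<Rightarrow> (nat \<Rightarrow> nat) set \<Rightarrow> 'k::field laurent monoid" where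
  "section_group r l a S = \<lparr>carrier = sections r l a S, monoid.mult = (+), one = 0\<rparr>"

text \<open>
  The Cech complex of \<open>O_X(a)\<close> for the standard affine cover, with cochains on all
  \<open>(q+1)\<close>-tuples of charts (not only on increasing ones).  It is graded by \<open>q :: int\<close>; there are
  no tuples, and hence only the zero cochain, in negative degree.
\<close>

definition tuples :: "nat \<Rightarrow> (nat \<Rightarrow> nat) \<Rightarrow> int \<Rightarrow> (nat \<Rightarrow> nat) list set" where
  "tuples r l q = {\<sigma> \<in> lists (charts r l). \<sigma> \<noteq> [] \<and> int (length \<sigma>) = q + 1}"

definition cech_group ::
  "nat \<Rightarrow> (nat \<Rightarrow> nat) \<Rightarrow> (nat \<Rightarrow> int) \<Rightarrow> int \<Rightarrow> ((nat \<Rightarrow> nat) list \<Rightarrow> 'k::field laurent) monoid" where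
  "cech_group r l a q = product_group (tuples r l q) (\<lambda>\<sigma>. section_group r l a (set \<sigma>))"

definition omit :: "nat \<Rightarrow> 'a list \<Rightarrow> 'a list" where
  "omit j \<sigma> = take j \<sigma> @ drop (Suc j) \<sigma>"

text \<open>
  The case distinction makes the differential out of degree \<open>-1\<close> zero; the alternating sum
  would there read off the value of an extensional function outside its domain.
\<close>

definition cech_diff ::
  "nat \<Rightarrow> (nat \<Rightarrow> nat) \<Rightarrow> int \<Rightarrow> ((nat \<Rightarrow> nat) list \<Rightarrow> 'k::field laurent) \<Rightarrow>
    (nat \<Rightarrow> nat) list \<Rightarrow> 'k laurent" where
  "cech_diff r l q c =
     (\<lambda>\<sigma> \<in> tuples r l (q + 1).
        if q < 0 then 0 else (\<Sum>j<length \<sigma>. (- 1) ^ j * c (omit j \<sigma>)))"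

definition cocycles ::
  "nat \<Rightarrow> (nat \<Rightarrow> nat) \<Rightarrow> (nat \<Rightarrow> int) \<Rightarrow> int \<Rightarrow> ((nat \<Rightarrow> nat) list \<Rightarrow> 'k::field laurent) set" where
  "cocycles r l a q = kernel (cech_group r l a q) (cech_group r l a (q + 1)) (cech_diff r l q)"

definition coboundaries ::
  "nat \<Rightarrow> (nat \<Rightarrow> nat) \<Rightarrow> (nat \<Rightarrow> int) \<Rightarrow> int \<Rightarrow> ((nat \<Rightarrow> nat) list \<Rightarrow> 'k::field laurent) set" where
  "coboundaries r l a q = cech_diff r l (q - 1) ` carrier (cech_group r l a (q - 1))"

text \<open>
  The cohomology \<open>H^q(X, a)\<close>.  Only the underlying additive group of the vector space is
  recorded, which suffices to speak about its vanishing.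
\<close>

definition cohomology ::
  "nat \<Rightarrow> (nat \<Rightarrow> nat) \<Rightarrow> (nat \<Rightarrow> int) \<Rightarrow> int \<Rightarrow> ((nat \<Rightarrow> nat) list \<Rightarrow> 'k::field laurent) set monoid" where
  "cohomology r l a q =
     (cech_group r l a q)\<lparr>carrier := cocycles r l a q\<rparr> Mod coboundaries r l a q"

text \<open>
  The term \<open>K_\<nu>(m)\<close> of the Weyman complex; the second index component \<open>i\<close> enumerates the
  \<open>(n+1) choose p\<close> copies of the \<open>p\<close>-th summand.
\<close>

definition weyman_term ::
  "nat \<Rightarrow> (nat \<Rightarrow> nat) \<Rightarrow> (nat \<Rightarrow> nat) \<Rightarrow> (nat \<Rightarrow> int) \<Rightarrow> int \<Rightarrow>
    (nat \<times> nat \<Rightarrow> ((nat \<Rightarrow> nat) list \<Rightarrow> 'k::field laurent) set) monoid" where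
  "weyman_term r l d m \<nu> =
     (let n = (\<Sum>k = 1..r. l k) in
      sum_group (SIGMA p:{0..n + 1}. {i. i < (n + 1) choose p})
        (\<lambda>(p, i). cohomology r l (\<lambda>k. m k - int p * int (d k)) (int p - \<nu>)))"

definition determinantal ::
  "'k::field itself \<Rightarrow> nat \<Rightarrow> (nat \<Rightarrow> nat) \<Rightarrow> (nat \<Rightarrow> nat) \<Rightarrow> (nat \<Rightarrow> int) \<Rightarrow> bool" where
  "determinantal _ r l d m \<longleftrightarrow>
     (\<forall>\<nu>. \<nu> \<notin> {0, 1} \<longrightarrow>
        trivial_group
          (weyman_term r l d m \<nu> :: (nat \<times> nat \<Rightarrow> ((nat \<Rightarrow> nat) list \<Rightarrow> 'k laurent) set) monoid))"

end

theory Submission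
  imports Defs "HOL-Library.Infinite_Set" "HOL-Library.Nat_Bijection" "Jordan_Normal_Form.Determinant"
begin

text \<open>
  Write \<open>a j p = m j - p * d j\<close>. If \<open>p\<close> is such that no \<open>a j p\<close> lies in \<open>[-l j, -1]\<close>, then
  \<open>H^q(X, a p)\<close> is nonzero for \<open>q\<close> the sum of the \<open>l j\<close> with \<open>a j p < -l j\<close>, so that
  \<open>p - q \<in> {0, 1}\<close>. For each \<open>j\<close> the excluded \<open>p\<close> form an interval of at most \<open>l j\<close> integers.
  The integers below the smallest admissible \<open>p\<close> are covered by the intervals counted by \<open>q\<close>, and
  if the lower bound for \<open>m k\<close> fails, the interval of \<open>k\<close> is too short, whence \<open>p < q\<close>. The upper
  bound follows in the same way from the largest admissible \<open>p\<close>.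

  For the nonvanishing, let \<open>N\<close> be the set of factors with \<open>a j p < -l j\<close>. In the degree of a Laurent
  monomial whose negative exponents are exactly those on the factors in \<open>N\<close>, the Cech complex consists
  of the cochains on tuples of charts that see all coordinates of each of these factors: relative
  cochains of a product of simplices modulo its boundary. The volume form (a determinant) is a
  cocycle, and its integral over the image of a cube that folds onto this product counts shuffles,
  which is nonzero in characteristic zero.
\<close>

section \<open>Determinantal cochains\<close>

text \<open>The classical formula for \<open>q!\<close> times the oriented volume of the simplex
  whose vertices have the coordinates \<open>g 0, ..., g (q - 1)\<close>. The column of ones shifts
  the index of \<open>g\<close> by one.\<close>

definition affine_det :: "nat \<Rightarrow> (nat \<Rightarrow> 'a \<Rightarrow> 'b::comm_ring_1) \<Rightarrow> 'a list \<Rightarrow> 'b" where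
  "affine_det q g \<sigma> =
     det (mat (Suc q) (Suc q) (\<lambda>(i, t). if t = 0 then 1 else g (t - 1) (\<sigma> ! i)))"

lemma length_omit: "j < length \<sigma> \<Longrightarrow> length (omit j \<sigma>) = length \<sigma> - 1"
  by (auto simp: omit_def)

lemma set_omit_subset: "set (omit j \<sigma>) \<subseteq> set \<sigma>"
  unfolding omit_def by (auto dest: in_set_takeD in_set_dropD)

lemma nth_omit:
  "j < length \<sigma> \<Longrightarrow> i < length \<sigma> - 1 \<Longrightarrow> omit j \<sigma> ! i = \<sigma> ! (if i < j then i else Suc i)"
  by (auto simp: omit_def nth_append min_def)

text \<open>A matrix with the column of ones written twice is singular, and its Laplace expansion
  along the first of the two columns is the alternating sum.\<close>

lemma affine_det_cocycle:
  assumes "length \<sigma> = Suc (Suc q)"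
  shows "(\<Sum>j<Suc (Suc q). (- 1) ^ j * affine_det q g (omit j \<sigma>)) = 0"
proof -
  define B where "B = mat (Suc (Suc q)) (Suc (Suc q))
    (\<lambda>(i, t). if t \<le> 1 then 1 else g (t - 2) (\<sigma> ! i))"
  have B: "B \<in> carrier_mat (Suc (Suc q)) (Suc (Suc q))"
    by (simp add: B_def)
  have "det B = 0"
    by (rule det_identical_columns[OF B, of 0 1]) (auto simp: B_def)
  moreover have "det B = (\<Sum>j<Suc (Suc q). (- 1) ^ j * affine_det q g (omit j \<sigma>))"
    unfolding laplace_expansion_column[OF B, of 0, OF zero_less_Suc]
  proof (rule sum.cong[OF refl])
    fix j assume "j \<in> {..<Suc (Suc q)}"
    then have j: "j < Suc (Suc q)" by simp
    have "mat_delete B j 0 = mat (Suc q) (Suc q)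
        (\<lambda>(i, t). if t = 0 then 1 else g (t - 1) (omit j \<sigma> ! i))"
      using j assms by (intro eq_matI) (auto simp: mat_delete_def B_def nth_omit numeral_2_eq_2)
    then show "B $$ (j, 0) * cofactor B j 0 = (- 1) ^ j * affine_det q g (omit j \<sigma>)"
      using j by (simp add: cofactor_def affine_det_def B_def)
  qed
  ultimately show ?thesis by simp
qed

text \<open>This and the next two lemmas are the ways in which the determinant degenerates on a
  tuple that misses the top, the bottom or an intermediate vertex of some factor.\<close>

lemma affine_det_zero_function:
  assumes "length \<sigma> = Suc q" "t < q" "\<And>s. s \<in> set \<sigma> \<Longrightarrow> g t s = 0"
  shows "affine_det q g \<sigma> = 0"
proof -
  define B where "B = mat (Suc q) (Suc q) (\<lambda>(i, t). if t = 0 then 1 else g (t - 1) (\<sigma> ! i))"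
  have B: "B \<in> carrier_mat (Suc q) (Suc q)"
    by (simp add: B_def)
  have "det B = (\<Sum>i<Suc q. B $$ (i, Suc t) * cofactor B i (Suc t))"
    using assms(2) by (intro laplace_expansion_column[OF B]) simp
  also have "\<dots> = 0"
    using assms by (intro sum.neutral) (auto simp: B_def)
  finally show ?thesis by (simp add: affine_det_def B_def)
qed

lemma affine_det_one_function:
  assumes "length \<sigma> = Suc q" "t < q" "\<And>s. s \<in> set \<sigma> \<Longrightarrow> g t s = 1"
  shows "affine_det q g \<sigma> = 0"
  unfolding affine_det_def
  by (rule det_identical_columns[of _ "Suc q" 0 "Suc t"]) (use assms in auto)

lemma affine_det_equal_functions:
  assumes "length \<sigma> = Suc q" "t < q" "u < q" "t \<noteq> u" "\<And>s. s \<in> set \<sigma> \<Longrightarrow> g t s = g u s"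
  shows "affine_det q g \<sigma> = 0"
  unfolding affine_det_def
  by (rule det_identical_columns[of _ "Suc q" "Suc t" "Suc u"]) (use assms in auto)

section \<open>The fundamental cycle of a cube\<close>

text \<open>A simplex of the standard triangulation of the \<open>q\<close>-cube: cube vertices are
  sets of directions, \<open>\<pi>\<close> is the order in which the directions are taken, and
  \<open>V\<close> maps the cube to the target.\<close>

definition cube_path :: "(nat set \<Rightarrow> 'a) \<Rightarrow> nat \<Rightarrow> (nat \<Rightarrow> nat) \<Rightarrow> 'a list" where
  "cube_path V q \<pi> = map (\<lambda>i. V (\<pi> ` {0..<i})) [0..<Suc q]"

lemma length_cube_path [simp]: "length (cube_path V q \<pi>) = Suc q"
  by (simp add: cube_path_def)

lemma nth_cube_path: "i \<le> q \<Longrightarrow> cube_path V q \<pi> ! i = V (\<pi> ` {0..<i})"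
  by (simp add: cube_path_def del: upt_Suc)

lemma set_cube_path: "set (cube_path V q \<pi>) = (\<lambda>i. V (\<pi> ` {0..<i})) ` {0..q}"
  by (simp add: cube_path_def atLeastLessThanSuc_atLeastAtMost del: upt_Suc)

lemma omit_0_cube_path:
  "set (omit 0 (cube_path V q \<pi>)) = (\<lambda>i. V (\<pi> ` {0..<i})) ` {1..q}"
proof -
  have "omit 0 (cube_path V q \<pi>) = map (\<lambda>i. V (\<pi> ` {0..<i})) [1..<Suc q]"
    by (simp add: omit_def cube_path_def drop_map del: upt_Suc)
  then show ?thesis
    by (simp add: atLeastLessThanSuc_atLeastAtMost del: upt_Suc)
qed

lemma omit_last_cube_path:
  "set (omit q (cube_path V q \<pi>)) = (\<lambda>i. V (\<pi> ` {0..<i})) ` {0..<q}"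
  by (simp add: omit_def cube_path_def)

lemma omit_cube_path_transpose:
  assumes "0 < j" "j < q"
  shows "omit j (cube_path V q (\<pi> \<circ> Transposition.transpose (j - 1) j)) = omit j (cube_path V q \<pi>)"
proof (rule nth_equalityI)
  fix i assume "i < length (omit j (cube_path V q (\<pi> \<circ> Transposition.transpose (j - 1) j)))"
  then have i: "i < q" using assms by (simp add: length_omit)
  define i' where "i' = (if i < j then i else Suc i)"
  have i': "i' \<le> q" "i' \<noteq> j" using i by (auto simp: i'_def)
  \<comment> \<open>Prefixes shorter than \<open>j\<close> contain neither moved point except
    possibly \<open>j - 1\<close> as an excluded end, longer ones contain both; the only prefix that
    changes has length \<open>j\<close> and is omitted.\<close>
  have "Transposition.transpose (j - 1) j ` {0..<i'} = {0..<i'}"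
  proof (cases "i' < j")
    case True
    then have "Transposition.transpose (j - 1) j x = x" if "x \<in> {0..<i'}" for x
      using that by (auto simp: Transposition.transpose_def)
    then show ?thesis by simp
  next
    case False
    then have "Transposition.transpose (j - 1) j permutes {0..<i'}"
      using assms i' by (intro permutes_swap_id) auto
    then show ?thesis by (rule permutes_image)
  qed
  then have "(\<pi> \<circ> Transposition.transpose (j - 1) j) ` {0..<i'} = \<pi> ` {0..<i'}"
    by (metis image_comp)
  then show "omit j (cube_path V q (\<pi> \<circ> Transposition.transpose (j - 1) j)) ! i
      = omit j (cube_path V q \<pi>) ! i"
    using i i' assms by (simp add: nth_omit nth_cube_path i'_def split: if_splits)
qed (use assms in \<open>simp add: length_omit\<close>)

text \<open>The interior faces cancel in pairs: omitting the \<open>j\<close>-th vertex of a path leaves no trace of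
  the order in which steps \<open>j - 1\<close> and \<open>j\<close> were taken.\<close>

lemma cube_cycle:
  fixes \<beta> :: "'a list \<Rightarrow> 'b::field_char_0"
  assumes "q > 0"
    and first: "\<And>\<pi>. \<pi> permutes {0..<q} \<Longrightarrow> \<beta> (omit 0 (cube_path V q \<pi>)) = 0"
    and last: "\<And>\<pi>. \<pi> permutes {0..<q} \<Longrightarrow> \<beta> (omit q (cube_path V q \<pi>)) = 0"
  shows "(\<Sum>\<pi> | \<pi> permutes {0..<q}. of_int (sign \<pi>) *
            (\<Sum>j<Suc q. (- 1) ^ j * \<beta> (omit j (cube_path V q \<pi>)))) = 0"
proof -
  let ?P = "{\<pi>. \<pi> permutes {0..<q}}"
  let ?T = "\<lambda>j. \<Sum>\<pi>\<in>?P. of_int (sign \<pi>) * \<beta> (omit j (cube_path V q \<pi>))"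
  have T0: "?T j = 0" if j: "j < Suc q" for j
  proof -
    consider "j = 0" | "j = q" | "0 < j" "j < q"
    using j by linarith
    then show ?thesis
    proof cases
      case 3
      let ?t = "Transposition.transpose (j - 1) j"
      have t: "?t permutes {0..<q}" using 3 by (intro permutes_swap_id) auto
      have "?T j = (\<Sum>\<pi>\<in>?P. of_int (sign (\<pi> \<circ> ?t)) * \<beta> (omit j (cube_path V q (\<pi> \<circ> ?t))))"
        by (rule sum_permutations_compose_right[OF t, where f =
            "\<lambda>\<pi>. of_int (sign \<pi>) * \<beta> (omit j (cube_path V q \<pi>))"])
      also have "\<dots> = (\<Sum>\<pi>\<in>?P. - (of_int (sign \<pi>) * \<beta> (omit j (cube_path V q \<pi>))))"
      proof (rule sum.cong[OF refl])
        fix \<pi> assume "\<pi> \<in> ?P"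
        then have "sign (\<pi> \<circ> ?t) = - sign \<pi>"
          using 3 t by (subst sign_compose) (auto simp: sign_swap_id intro: permutes_imp_permutation[of "{0..<q}"])
        then show "of_int (sign (\<pi> \<circ> ?t)) * \<beta> (omit j (cube_path V q (\<pi> \<circ> ?t)))
            = - (of_int (sign \<pi>) * \<beta> (omit j (cube_path V q \<pi>)))"
          using 3 omit_cube_path_transpose[of j q V \<pi>] by simp
      qed
      \<comment> \<open>So \<open>?T j\<close> is its own negative and vanishes in characteristic
        zero.\<close>
      also have "\<dots> = - ?T j" by (rule sum_negf)
      finally show ?thesis by simp
    qed (auto simp: first last intro!: sum.neutral)
  qed
  have "(\<Sum>\<pi>\<in>?P. of_int (sign \<pi>) * (\<Sum>j<Suc q. (- 1) ^ j * \<beta> (omit j (cube_path V q \<pi>))))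
      = (\<Sum>\<pi>\<in>?P. \<Sum>j<Suc q. (- 1) ^ j * (of_int (sign \<pi>) * \<beta> (omit j (cube_path V q \<pi>))))"
    by (simp add: sum_distrib_left mult.left_commute del: sum.lessThan_Suc)
  also have "\<dots> = (\<Sum>j<Suc q. (- 1) ^ j * ?T j)"
    by (subst sum.swap) (simp add: sum_distrib_left del: sum.lessThan_Suc)
  also have "\<dots> = 0"
    by (rule sum.neutral) (use T0 in auto)
  finally show ?thesis .
qed

text \<open>In the order in which the path takes the directions, the coordinates of its vertices
  form a triangular matrix with ones on the diagonal; undoing this reordering of the columns
  contributes the sign.\<close>

lemma affine_det_cube_path:
  fixes g :: "nat \<Rightarrow> 'a \<Rightarrow> 'b::comm_ring_1"
  assumes \<pi>: "\<pi> permutes {0..<q}"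
    and g: "\<And>i t. i \<le> q \<Longrightarrow> t < q \<Longrightarrow> g t (V (\<pi> ` {0..<i})) = of_bool (t \<in> \<pi> ` {0..<i})"
  shows "affine_det q g (cube_path V q \<pi>) = of_int (sign \<pi>)"
proof -
  define A :: "'b mat" where "A = mat (Suc q) (Suc q)
    (\<lambda>(i, t). if t = 0 then 1 else g (t - 1) (cube_path V q \<pi> ! i))"
  define L :: "'b mat" where "L = mat q q (\<lambda>(i, t). of_bool (t \<le> i))"
  have A: "A \<in> carrier_mat (Suc q) (Suc q)" by (simp add: A_def)
  have L: "L \<in> carrier_mat q q" by (simp add: L_def)
  define \<rho> where "\<rho> = inv_into UNIV \<pi>"
  have \<rho>: "\<rho> permutes {0..<q}" unfolding \<rho>_def using \<pi> by (rule permutes_inv)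
  have mem: "t \<in> \<pi> ` {0..<i} \<longleftrightarrow> \<rho> t < i" for t i
  proof
    assume "\<rho> t < i"
    then have "\<pi> (\<rho> t) \<in> \<pi> ` {0..<i}" by simp
    then show "t \<in> \<pi> ` {0..<i}" by (simp add: \<rho>_def permutes_inverses(1)[OF \<pi>])
  qed (auto simp: \<rho>_def permutes_inverses(2)[OF \<pi>])
  have "affine_det q g (cube_path V q \<pi>) = det A"
    by (simp add: affine_det_def A_def)
  also have "\<dots> = (\<Sum>t<Suc q. A $$ (0, t) * cofactor A 0 t)"
    by (rule laplace_expansion_row[OF A]) simp
  \<comment> \<open>The path starts at the empty set, so the first row is
    \<open>1, 0, ..., 0\<close>.\<close>
  also have "\<dots> = A $$ (0, 0) * cofactor A 0 0"
    using g[of 0] by (subst sum.lessThan_Suc_shift) (simp add: A_def nth_cube_path)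
  also have "\<dots> = det (mat_delete A 0 0)"
    by (simp add: cofactor_def A_def)
  \<comment> \<open>Entry \<open>(i, t)\<close> records whether \<open>\<rho> t \<le> i\<close>,
    where \<open>\<rho> t\<close> is the time at which direction \<open>t\<close> is taken. The
    transposes turn this permutation of columns into one of rows.\<close>
  also have "mat_delete A 0 0 = transpose_mat (mat q q (\<lambda>(i, j). transpose_mat L $$ (\<rho> i, j)))"
  proof (rule eq_matI)
    fix i t assume "i < dim_row (transpose_mat (mat q q (\<lambda>(i, j). transpose_mat L $$ (\<rho> i, j))))"
      "t < dim_col (transpose_mat (mat q q (\<lambda>(i, j). transpose_mat L $$ (\<rho> i, j))))"
    then have it: "i < q" "t < q" by auto
    then have "\<rho> t < q" using permutes_in_image[OF \<rho>, of t] by simp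
    then show "mat_delete A 0 0 $$ (i, t)
        = transpose_mat (mat q q (\<lambda>(i, j). transpose_mat L $$ (\<rho> i, j))) $$ (i, t)"
      using it g[of "Suc i" t]
      by (simp add: mat_delete_def A_def L_def nth_cube_path mem less_Suc_eq_le)
  qed (auto simp: A_def mat_delete_def)
  also have "det \<dots> = det (mat q q (\<lambda>(i, j). transpose_mat L $$ (\<rho> i, j)))"
    by (rule det_transpose[of _ q]) simp
  also have "\<dots> = of_int (sign (\<rho>)) * det (transpose_mat L)"
    by (rule det_permute_rows[OF _ \<rho>]) (simp add: L_def)
  also have "det (transpose_mat L) = det L"
    by (rule det_transpose[OF L])
  also have "det L = prod_list (diag_mat L)"
    by (rule det_lower_triangular[OF _ L]) (simp add: L_def)
  also have "\<dots> = 1"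
    by (simp add: prod_list_diag_prod L_def)
  also have "sign (\<rho>) = sign \<pi>"
    unfolding \<rho>_def using \<pi> by (intro sign_inverse permutes_imp_permutation[of "{0..<q}"]) auto
  finally show ?thesis by simp
qed


section \<open>Nonvanishing of the cohomology\<close>

lemma omit_in_tuples:
  assumes "\<sigma> \<in> tuples r l (q + 1)" "0 \<le> q" "j < length \<sigma>"
  shows "omit j \<sigma> \<in> tuples r l q"
  using assms set_omit_subset[of j \<sigma>] length_omit[of j \<sigma>] by (force simp: tuples_def)

lemma lookup_minus_one_power:
  "Poly_Mapping.lookup ((- 1) ^ j * f) x = (- 1) ^ j * Poly_Mapping.lookup (f :: 'k::field laurent) x"
  by (cases "even j") simp_all

lemma section_group_simps:
  "carrier (section_group r l a S) = sections r l a S"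
  "\<one>\<^bsub>section_group r l a S\<^esub> = 0"
  "x \<otimes>\<^bsub>section_group r l a S\<^esub> y = x + y"
  by (simp_all add: section_group_def)

lemma zero_in_sections: "0 \<in> sections r l a S"
  by (simp add: sections_def)

text \<open>The cube has one direction for every nonzero vertex \<open>(k, j)\<close> of the simplices \<open>k \<in> N\<close>; a
  set of directions is sent to the chart that takes in each factor the largest \<open>j\<close> reached.
  The directions \<open>t < q\<close> are numbered so that within each factor \<open>j\<close> increases.\<close>

locale simplex_product =
  fixes r q :: nat and l :: "nat \<Rightarrow> nat" and N :: "nat set" and enc :: "nat \<Rightarrow> nat \<times> nat"
  assumes N: "N \<subseteq> {1..r}" and pos: "\<And>k. k \<in> N \<Longrightarrow> l k \<ge> 1"
    and enc: "bij_betw enc {0..<q} (SIGMA k:N. {1..l k})"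
    and enc_mono: "\<And>t u. t < q \<Longrightarrow> u < q \<Longrightarrow> fst (enc t) = fst (enc u) \<Longrightarrow>
      snd (enc t) < snd (enc u) \<Longrightarrow> t < u"
begin

section \<open>The folding map from the cube to the product of simplices\<close>

definition height :: "nat set \<Rightarrow> nat \<Rightarrow> nat" where
  "height A k = Max (insert 0 {j. (k, j) \<in> enc ` A})"

definition vertex :: "nat set \<Rightarrow> nat \<Rightarrow> nat" where
  "vertex A = (\<lambda>k\<in>{1..r}. height A k)"

text \<open>Tuples that are not full belong to the boundary of the product of simplices, where
  relative cochains vanish.\<close>

definition full :: "(nat \<Rightarrow> nat) list \<Rightarrow> bool" where
  "full \<sigma> \<longleftrightarrow> (\<forall>k\<in>N. \<forall>j\<le>l k. \<exists>s\<in>set \<sigma>. s k = j)"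

text \<open>Embeds vertex \<open>j\<close> of a factor as the point whose first \<open>j\<close>
  coordinates are 1 and whose other coordinates are 0.\<close>

definition threshold :: "nat \<Rightarrow> (nat \<Rightarrow> nat) \<Rightarrow> 'b::comm_ring_1" where
  "threshold t s = of_bool (snd (enc t) \<le> s (fst (enc t)))"

lemma enc_in: "t < q \<Longrightarrow> fst (enc t) \<in> N \<and> 1 \<le> snd (enc t) \<and> snd (enc t) \<le> l (fst (enc t))"
  using bij_betw_apply[OF enc, of t] by (cases "enc t") auto

lemma enc_obtain:
  assumes "k \<in> N" "1 \<le> j" "j \<le> l k"
  obtains t where "t < q" "enc t = (k, j)"
proof -
  have "(k, j) \<in> enc ` {0..<q}" using enc assms by (auto simp: bij_betw_def)
  then show ?thesis using that by auto
qed

lemma enc_inj: "t < q \<Longrightarrow> u < q \<Longrightarrow> enc t = enc u \<Longrightarrow> t = u"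
  using enc by (auto simp: bij_betw_def inj_on_def)

lemma mem_enc_image:
  assumes "A \<subseteq> {0..<q}" "t < q" "enc t \<in> enc ` A"
  shows "t \<in> A"
proof -
  obtain u where "u \<in> A" "enc t = enc u" using assms(3) by blast
  moreover from this have "u < q" using assms(1) by auto
  ultimately show ?thesis using enc_inj[OF assms(2), of u] by simp
qed

lemma finite_heights:
  assumes "A \<subseteq> {0..<q}"
  shows "finite {j. (k, j) \<in> enc ` A}"
proof (rule finite_subset)
  show "{j. (k, j) \<in> enc ` A} \<subseteq> snd ` enc ` A"
    by (metis imageI mem_Collect_eq snd_conv subsetI)
  show "finite (snd ` enc ` A)"
    using finite_subset[OF assms] by simp
qed

lemma le_height: "A \<subseteq> {0..<q} \<Longrightarrow> (k, j) \<in> enc ` A \<Longrightarrow> j \<le> height A k"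
  unfolding height_def using finite_heights by (intro Max_ge) auto

lemma height_cases:
  assumes "A \<subseteq> {0..<q}"
  shows "height A k = 0 \<or> (k, height A k) \<in> enc ` A"
proof -
  have "height A k \<in> insert 0 {j. (k, j) \<in> enc ` A}"
    unfolding height_def by (rule Max_in) (use finite_heights[OF assms] in auto)
  then show ?thesis by auto
qed

lemma vertex_height: "k \<in> N \<Longrightarrow> vertex A k = height A k"
  using N by (auto simp: vertex_def)

lemma vertex_in_charts:
  assumes A: "A \<subseteq> {0..<q}"
  shows "vertex A \<in> charts r l"
proof -
  have "height A k \<le> l k" for k
    using height_cases[OF A, of k]
  proof
    assume "(k, height A k) \<in> enc ` A"
    then obtain t where "t \<in> A" "enc t = (k, height A k)" by auto
    then show ?thesis using enc_in[of t] A by auto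
  qed simp
  then show ?thesis by (auto simp: vertex_def charts_def)
qed

section \<open>Outer faces of the cube and the boundary of the product\<close>

lemma prefix_subset:
  assumes "\<pi> permutes {0..<q}" "i \<le> q"
  shows "\<pi> ` {0..<i} \<subseteq> {0..<q}"
  using image_mono[of "{0..<i}" "{0..<q}" \<pi>] permutes_image[OF assms(1)] assms(2) by simp

lemma cube_path_in_charts:
  assumes "\<pi> permutes {0..<q}"
  shows "set (cube_path vertex q \<pi>) \<subseteq> charts r l"
  unfolding set_cube_path
proof (rule image_subsetI)
  fix i assume "i \<in> {0..q}"
  then show "vertex (\<pi> ` {0..<i}) \<in> charts r l"
    using prefix_subset[OF assms, of i] by (intro vertex_in_charts) simp
qed

text \<open>All remaining sets contain the direction \<open>\<pi> 0\<close>, so in its factor the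
  height 0 no longer occurs.\<close>

lemma not_full_omit_first:
  assumes "\<pi> permutes {0..<q}" "q > 0"
  shows "\<not> full (omit 0 (cube_path vertex q \<pi>))"
proof
  assume full: "full (omit 0 (cube_path vertex q \<pi>))"
  obtain k j where kj: "enc (\<pi> 0) = (k, j)" by (rule prod.exhaust)
  have "\<pi> 0 < q" using permutes_in_image[OF assms(1), of 0] assms(2) by simp
  then have k: "k \<in> N" "1 \<le> j" using enc_in[of "\<pi> 0"] kj by auto
  then have "\<exists>s\<in>set (omit 0 (cube_path vertex q \<pi>)). s k = 0"
    using full unfolding full_def by blast
  then obtain i where i: "1 \<le> i" "i \<le> q" "vertex (\<pi> ` {0..<i}) k = 0"
    by (auto simp: omit_0_cube_path)
  have "(k, j) \<in> enc ` \<pi> ` {0..<i}"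
    using i kj by (metis atLeastLessThan_iff imageI le0 less_eq_Suc_le One_nat_def)
  then have "j \<le> height (\<pi> ` {0..<i}) k"
    using le_height prefix_subset[OF assms(1)] i by blast
  then show False using i k by (simp add: vertex_height)
qed

text \<open>A positive height \<open>j\<close> in factor \<open>k\<close> requires the direction
  \<open>(k, j)\<close> in the set; the direction taken last belongs to none of the remaining
  sets.\<close>

lemma not_full_omit_last:
  assumes \<pi>: "\<pi> permutes {0..<q}" and "q > 0"
  shows "\<not> full (omit q (cube_path vertex q \<pi>))"
proof
  assume full: "full (omit q (cube_path vertex q \<pi>))"
  define u where "u = \<pi> (q - 1)"
  obtain k j where kj: "enc u = (k, j)" by (rule prod.exhaust)
  have u: "u < q" using permutes_in_image[OF assms(1), of "q - 1"] assms(2) by (simp add: u_def)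
  then have k: "k \<in> N" "1 \<le> j" "j \<le> l k" using enc_in[of u] kj by auto
  then have "\<exists>s\<in>set (omit q (cube_path vertex q \<pi>)). s k = j"
    using full unfolding full_def by blast
  then obtain i where i: "i < q" "vertex (\<pi> ` {0..<i}) k = j"
    by (auto simp: omit_last_cube_path)
  have "\<pi> ` {0..<i} \<subseteq> {0..<q}" using prefix_subset[OF \<pi>] i by simp
  moreover from this have "(k, j) \<in> enc ` \<pi> ` {0..<i}"
    using height_cases[of "\<pi> ` {0..<i}" k] i k by (auto simp: vertex_height)
  ultimately have "u \<in> \<pi> ` {0..<i}"
    using kj u mem_enc_image by metis
  then obtain x where "x < i" "\<pi> x = \<pi> (q - 1)" by (auto simp: u_def)
  then show False using injD[OF permutes_inj[OF \<pi>], of x "q - 1"] i by simp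
qed

section \<open>Values of the volume cocycle on the paths\<close>

lemma affine_det_not_full:
  assumes "length \<sigma> = Suc q" "set \<sigma> \<subseteq> charts r l" "\<not> full \<sigma>"
  shows "affine_det q threshold \<sigma> = 0"
proof -
  obtain k j where k: "k \<in> N" and j: "j \<le> l k" and missing: "\<And>s. s \<in> set \<sigma> \<Longrightarrow> s k \<noteq> j"
    using assms(3) by (auto simp: full_def)
  have le: "s k \<le> l k" if "s \<in> set \<sigma>" for s
    using assms(2) that k N by (fastforce simp: charts_def)
  \<comment> \<open>If \<open>j = 0\<close> is missing, the threshold at \<open>(k, 1)\<close> is
    constantly 1; if \<open>j = l k\<close> is missing, the threshold at \<open>(k, j)\<close> is
    constantly 0; otherwise the thresholds at \<open>(k, j)\<close> and \<open>(k, Suc j)\<close>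
    agree.\<close>
  consider "j = 0" | "j = l k" "1 \<le> j" | "1 \<le> j" "j < l k" using j by linarith
  then show ?thesis
  proof cases
    case 1
    obtain t where "t < q" "enc t = (k, 1)" using enc_obtain[of k 1] k pos by auto
    with 1 missing show ?thesis
      by (intro affine_det_one_function[OF assms(1)]) (auto simp: threshold_def Suc_le_eq)
  next
    case 2
    obtain t where "t < q" "enc t = (k, j)" using enc_obtain[of k j] k 2 by auto
    with 2 missing le show ?thesis
      by (intro affine_det_zero_function[OF assms(1)]) (fastforce simp: threshold_def)+
  next
    case 3
    obtain t where t: "t < q" "enc t = (k, j)" using enc_obtain[of k j] k 3 by auto
    obtain u where u: "u < q" "enc u = (k, Suc j)" using enc_obtain[of k "Suc j"] k 3 by auto
    have "t \<noteq> u" using t u by auto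
    with t u show ?thesis
    proof (intro affine_det_equal_functions[OF assms(1)])
      fix s assume "s \<in> set \<sigma>"
      then have "j \<le> s k \<longleftrightarrow> Suc j \<le> s k" using missing[of s] by auto
      then show "threshold t s = threshold u s" using t u by (simp add: threshold_def)
    qed
  qed
qed

text \<open>Heights never decrease along a path, so a path that attains every height takes the
  directions of each factor in increasing order. The thresholds then detect exactly which directions
  have been taken.\<close>

lemma affine_det_full:
  assumes \<pi>: "\<pi> permutes {0..<q}" and full: "full (cube_path vertex q \<pi>)"
  shows "affine_det q threshold (cube_path vertex q \<pi>) = of_int (sign \<pi>)"
proof (rule affine_det_cube_path[OF \<pi>])
  fix i t assume i: "i \<le> q" and t: "t < q"
  obtain k j where kj: "enc t = (k, j)" by (rule prod.exhaust)
  then have k: "k \<in> N" "1 \<le> j" "j \<le> l k" using enc_in[OF t] by auto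
  have "t \<in> \<pi> ` {0..<i} \<longleftrightarrow> j \<le> height (\<pi> ` {0..<i}) k"
  proof
    assume "t \<in> \<pi> ` {0..<i}"
    then have "(k, j) \<in> enc ` \<pi> ` {0..<i}" using kj by (metis imageI)
    then show "j \<le> height (\<pi> ` {0..<i}) k" using le_height prefix_subset[OF \<pi> i] by blast
  next
    assume ge: "j \<le> height (\<pi> ` {0..<i}) k"
    have "\<exists>s\<in>set (cube_path vertex q \<pi>). s k = j"
      using full k unfolding full_def by blast
    then obtain i' where i': "i' \<le> q" "height (\<pi> ` {0..<i'}) k = j"
      using k by (auto simp: set_cube_path vertex_height)
    have "(k, j) \<in> enc ` \<pi> ` {0..<i'}"
      using height_cases[OF prefix_subset[OF \<pi> i'(1)], of k] i' k by auto
    then have mem: "t \<in> \<pi> ` {0..<i'}"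
      using kj t mem_enc_image prefix_subset[OF \<pi> i'(1)] by metis
    show "t \<in> \<pi> ` {0..<i}"
    proof (cases "i' \<le> i")
      case True
      then have "\<pi> ` {0..<i'} \<subseteq> \<pi> ` {0..<i}" by (intro image_mono) auto
      with mem show ?thesis by blast
    next
      \<comment> \<open>The prefix of length \<open>i\<close> is contained in the one of length
        \<open>i'\<close>, so its height is also at most \<open>j\<close>, hence equal to
        \<open>j\<close>. Being positive, it is attained by the direction
        \<open>(k, j)\<close>.\<close>
      case False
      have "(k, height (\<pi> ` {0..<i}) k) \<in> enc ` \<pi> ` {0..<i}"
        using height_cases[OF prefix_subset[OF \<pi> i], of k] ge k by auto
      moreover have "enc ` \<pi> ` {0..<i} \<subseteq> enc ` \<pi> ` {0..<i'}"
        using False by (intro image_mono) auto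
      ultimately have "height (\<pi> ` {0..<i}) k \<le> j"
        using le_height[OF prefix_subset[OF \<pi> i'(1)]] i' by blast
      with ge have "height (\<pi> ` {0..<i}) k = j" by simp
      then have "(k, j) \<in> enc ` \<pi> ` {0..<i}"
        using height_cases[OF prefix_subset[OF \<pi> i], of k] k by auto
      then show ?thesis
        using kj t mem_enc_image prefix_subset[OF \<pi> i] by metis
    qed
  qed
  then show "threshold t (vertex (\<pi> ` {0..<i})) = of_bool (t \<in> \<pi> ` {0..<i})"
    using kj k by (simp add: threshold_def vertex_height)
qed

text \<open>The numbering increases within each factor, so just after direction
  \<open>(k, j)\<close> is taken no larger direction of factor \<open>k\<close> has been taken and
  the height there is \<open>j\<close>.\<close>

lemma full_cube_path_id: "full (cube_path vertex q id)"
  unfolding full_def set_cube_path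
proof (intro ballI allI impI)
  fix k j assume k: "k \<in> N" and j: "j \<le> l k"
  show "\<exists>s\<in>(\<lambda>i. vertex (id ` {0..<i})) ` {0..q}. s k = j"
  proof (cases "j = 0")
    case True
    have "vertex (id ` {0..<0}) k = 0" using k by (simp add: vertex_height height_def)
    with True show ?thesis by (intro bexI[of _ "vertex (id ` {0..<0})"] imageI) auto
  next
    case False
    then obtain t where t: "t < q" "enc t = (k, j)" using enc_obtain[of k j] k j by auto
    let ?A = "{0..<Suc t}"
    have A: "?A \<subseteq> {0..<q}" using t by auto
    have "(k, j) \<in> enc ` ?A" using t by (metis imageI atLeastLessThan_iff lessI le0)
    then have ge: "j \<le> height ?A k" using le_height[OF A] by blast
    then have "(k, height ?A k) \<in> enc ` ?A" using height_cases[OF A, of k] False by auto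
    then obtain u where "u \<in> ?A" "enc u = (k, height ?A k)" by (metis imageE)
    then have u: "u \<le> t" "enc u = (k, height ?A k)" by auto
    have "\<not> j < height ?A k"
    proof
      assume "j < height ?A k"
      then have "t < u" using enc_mono[of t u] t u by simp
      with u show False by simp
    qed
    with ge have "vertex (id ` ?A) k = j" using k by (simp add: vertex_height)
    then show ?thesis using t by (intro bexI[of _ "vertex (id ` ?A)"] imageI) auto
  qed
qed

text \<open>A full path contributes the square of a sign and any other path contributes 0, so the
  sum counts the full paths. The identity gives one, and the count stays nonzero in characteristic
  zero.\<close>

lemma pairing_affine_det_nonzero:
  "(\<Sum>\<pi> | \<pi> permutes {0..<q}. of_int (sign \<pi>) * affine_det q threshold (cube_path vertex q \<pi>))
     \<noteq> (0 :: 'b::field_char_0)"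
proof -
  let ?F = "{\<pi>. \<pi> permutes {0..<q} \<and> full (cube_path vertex q \<pi>)}"
  have fin: "finite {\<pi>. \<pi> permutes {0..<q}}" by (rule finite_permutations) simp
  have "(\<Sum>\<pi> | \<pi> permutes {0..<q}.
          of_int (sign \<pi>) * affine_det q threshold (cube_path vertex q \<pi>))
      = (\<Sum>\<pi> | \<pi> permutes {0..<q}. of_bool (full (cube_path vertex q \<pi>)) :: 'b)"
  proof (rule sum.cong[OF refl])
    fix \<pi> assume "\<pi> \<in> {\<pi>. \<pi> permutes {0..<q}}"
    then have \<pi>: "\<pi> permutes {0..<q}" by simp
    show "of_int (sign \<pi>) * affine_det q threshold (cube_path vertex q \<pi>)
        = (of_bool (full (cube_path vertex q \<pi>)) :: 'b)"
      by (cases "full (cube_path vertex q \<pi>)")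
         (simp_all add: affine_det_not_full cube_path_in_charts \<pi> affine_det_full sign_idempotent
           flip: of_int_mult)
  qed
  also have "\<dots> = of_nat (card ?F)"
    using fin by (simp add: Collect_conj_eq)
  also have "\<dots> \<noteq> 0"
  proof -
    have "id \<in> ?F" using full_cube_path_id by (simp add: permutes_id)
    moreover have "finite ?F" using fin by (rule rev_finite_subset) auto
    ultimately show ?thesis by (metis card_gt_0_iff empty_iff of_nat_eq_0_iff less_irrefl)
  qed
  finally show ?thesis .
qed

section \<open>A nontrivial class supported on one Laurent monomial\<close>

lemma exists_cocycle_not_coboundary:
  assumes neg: "\<And>k. k \<in> N \<Longrightarrow> a k < - int (l k)"
    and nonneg: "\<And>k. k \<in> {1..r} - N \<Longrightarrow> 0 \<le> a k"
  shows "\<exists>c \<in> cocycles r l a (int q). c \<notin>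
    (coboundaries r l a (int q) :: ((nat \<Rightarrow> nat) list \<Rightarrow> 'k::field_char_0 laurent) set)"
proof -
  \<comment> \<open>An exponent of multidegree \<open>a\<close> that is negative on all coordinates
    of the factors in \<open>N\<close> and on no others. For \<open>k\<close> in \<open>N\<close>,
    coordinate 0 balances the \<open>l k\<close> entries \<open>- 1\<close>; its exponent
    \<open>a k + l k\<close> is negative by \<open>neg\<close>.\<close>
  define w where "w = (\<lambda>(k, j). if (k, j) \<in> coords r l then
      (if k \<in> N then if j = 0 then a k + int (l k) else - 1 else if j = 0 then a k else 0) else 0)"
  have "finite {x. w x \<noteq> 0}"
    by (rule finite_subset[of _ "coords r l"]) (auto simp: w_def coords_def split: if_splits)
  then obtain e where e: "Poly_Mapping.lookup e = w"
    using Abs_poly_mapping_inverse[of w] by blast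
  have keys: "Poly_Mapping.keys e \<subseteq> coords r l"
    by (auto simp: in_keys_iff e w_def split: if_splits)
  have degree: "(\<Sum>j = 0..l k. Poly_Mapping.lookup e (k, j)) = a k" if "k \<in> {1..r}" for k
    using that by (simp add: sum.atLeast_Suc_atMost e w_def coords_def)
  have negative: "Poly_Mapping.lookup e (k, j) < 0 \<longleftrightarrow> k \<in> N" if "(k, j) \<in> coords r l" for k j
    using that neg[of k] nonneg[of k] by (auto simp: e w_def coords_def)
  \<comment> \<open>The monomial \<open>e\<close> is a section over the charts of a tuple exactly
    when the tuple is full, which identifies the part of degree \<open>e\<close> with relative
    cochains.\<close>
  have full_iff: "(\<forall>(k, j) \<in> coords r l. Poly_Mapping.lookup e (k, j) < 0 \<longrightarrow> (\<exists>s\<in>set \<sigma>. s k = j)) \<longleftrightarrow> full \<sigma>"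
    (is "?L \<longleftrightarrow> _") for \<sigma>
  proof
    assume ?L
    then show "full \<sigma>"
      using N negative by (fastforce simp: full_def coords_def)
  qed (use negative in \<open>auto simp: full_def coords_def\<close>)
  have single_section: "Poly_Mapping.single e x \<in> sections r l a (set \<sigma>)"
    if "x = 0 \<or> full \<sigma>" for x :: 'k and \<sigma>
    using that keys degree by (auto simp: sections_def full_iff)
  have lookup_section: "Poly_Mapping.lookup f e = 0"
    if "f \<in> sections r l a (set \<sigma>)" "\<not> full \<sigma>" for f :: "'k laurent" and \<sigma>
  proof (rule ccontr)
    assume "Poly_Mapping.lookup f e \<noteq> 0"
    then have "e \<in> Poly_Mapping.keys f" by (simp add: in_keys_iff)
    with that(1) have "\<forall>(k, j) \<in> coords r l. Poly_Mapping.lookup e (k, j) < 0 \<longrightarrow> (\<exists>s\<in>set \<sigma>. s k = j)"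
      unfolding sections_def by blast
    with that(2) show False by (simp only: full_iff)
  qed
  have tuplesD: "length \<sigma> = Suc q" "set \<sigma> \<subseteq> charts r l" if "\<sigma> \<in> tuples r l (int q)" for \<sigma>
    using that by (auto simp: tuples_def)
  \<comment> \<open>The volume cocycle placed in degree \<open>e\<close>; it takes values in
    sections because the determinant vanishes on tuples that are not full.\<close>
  define c :: "(nat \<Rightarrow> nat) list \<Rightarrow> 'k laurent" where
    "c = (\<lambda>\<sigma>\<in>tuples r l (int q). Poly_Mapping.single e (affine_det q threshold \<sigma>))"
  have carrier: "c \<in> carrier (cech_group r l a (int q))"
    unfolding cech_group_def carrier_product_group section_group_simps c_def
  proof (rule restrict_PiE[THEN iffD2], rule Pi_I)
    fix \<sigma> assume \<sigma>: "\<sigma> \<in> tuples r l (int q)"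
    have "affine_det q threshold \<sigma> = (0 :: 'k) \<or> full \<sigma>"
      by (cases "full \<sigma>") (simp_all add: affine_det_not_full tuplesD[OF \<sigma>])
    then show "Poly_Mapping.single e (affine_det q threshold \<sigma> :: 'k) \<in> sections r l a (set \<sigma>)"
      by (rule single_section)
  qed
  have "cech_diff r l (int q) c = (\<lambda>\<sigma>\<in>tuples r l (int q + 1). 0)"
    unfolding cech_diff_def
  proof (rule restrict_ext)
    fix \<sigma> assume \<sigma>: "\<sigma> \<in> tuples r l (int q + 1)"
    then have len: "length \<sigma> = Suc (Suc q)" by (auto simp: tuples_def)
    have "(\<Sum>j<length \<sigma>. (- 1) ^ j * c (omit j \<sigma>)) = 0"
    proof (rule poly_mapping_eqI)
      fix x
      have "Poly_Mapping.lookup (\<Sum>j<length \<sigma>. (- 1) ^ j * c (omit j \<sigma>)) x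
          = (\<Sum>j<Suc (Suc q). (- 1) ^ j * affine_det q threshold (omit j \<sigma>)) * of_bool (e = x)"
        unfolding lookup_sum sum_distrib_right len
      proof (rule sum.cong[OF refl])
        fix j assume "j \<in> {..<Suc (Suc q)}"
        then have "omit j \<sigma> \<in> tuples r l (int q)"
          using omit_in_tuples[OF \<sigma>] len by simp
        then show "Poly_Mapping.lookup ((- 1) ^ j * c (omit j \<sigma>)) x
            = (- 1) ^ j * affine_det q threshold (omit j \<sigma>) * of_bool (e = x)"
          by (simp add: lookup_minus_one_power c_def lookup_single)
      qed
      then show "Poly_Mapping.lookup (\<Sum>j<length \<sigma>. (- 1) ^ j * c (omit j \<sigma>)) x = Poly_Mapping.lookup 0 x"
        using affine_det_cocycle[OF len, of "threshold :: nat \<Rightarrow> _ \<Rightarrow> 'k"] by simp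
    qed
    then show "(if int q < 0 then 0 else \<Sum>j<length \<sigma>. (- 1) ^ j * c (omit j \<sigma>)) = 0"
      by simp
  qed
  with carrier have "c \<in> cocycles r l a (int q)"
    by (simp add: cocycles_def kernel_def cech_group_def section_group_simps)
  moreover have "c \<notin> coboundaries r l a (int q)"
  proof
    assume "c \<in> coboundaries r l a (int q)"
    then obtain b where b: "b \<in> carrier (cech_group r l a (int q - 1))"
      and cb: "c = cech_diff r l (int q - 1) b"
      unfolding coboundaries_def by blast
    have path: "cube_path vertex q \<pi> \<in> tuples r l (int q)" if "\<pi> permutes {0..<q}" for \<pi>
    proof -
      have "cube_path vertex q \<pi> \<noteq> []" by (metis length_cube_path list.size(3) nat.distinct(1))
      then show ?thesis using cube_path_in_charts[OF that] by (auto simp: tuples_def)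
    qed
    have "(\<Sum>\<pi> | \<pi> permutes {0..<q}.
        of_int (sign \<pi>) * affine_det q threshold (cube_path vertex q \<pi>)) = (0 :: 'k)"
    proof (cases "q = 0")
      \<comment> \<open>The differential out of degree \<open>-1\<close> is zero by definition, so
        \<open>c\<close> vanishes on the path.\<close>
      case True
      then have "affine_det q threshold (cube_path vertex q \<pi>) = (0 :: 'k)"
        if "\<pi> permutes {0..<q}" for \<pi>
        using fun_cong[OF cb, of "cube_path vertex q \<pi>"] path[OF that]
        by (simp add: c_def cech_diff_def) (metis lookup_single_eq lookup_zero)
      then show ?thesis by (intro sum.neutral) auto
    next
      case False
      \<comment> \<open>The part of \<open>b\<close> in degree \<open>e\<close> vanishes on tuples
        that are not full, in particular on the outer faces of the cube. Hence
        \<open>cube_cycle\<close> makes the pairing with its coboundary zero.\<close>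
      define \<beta> where "\<beta> = (\<lambda>\<sigma>. Poly_Mapping.lookup (b \<sigma>) e)"
      have vanish: "\<beta> (omit j (cube_path vertex q \<pi>)) = 0"
        if "\<pi> permutes {0..<q}" "j \<le> q" "\<not> full (omit j (cube_path vertex q \<pi>))" for \<pi> j
      proof -
        have "omit j (cube_path vertex q \<pi>) \<in> tuples r l (int q - 1)"
          using omit_in_tuples[of _ r l "int q - 1" j] path[OF that(1)] that(2) False by simp
        then have "b (omit j (cube_path vertex q \<pi>)) \<in> sections r l a (set (omit j (cube_path vertex q \<pi>)))"
          using b by (auto simp: cech_group_def section_group_simps)
        then show ?thesis unfolding \<beta>_def using that(3) by (rule lookup_section)
      qed
      have "affine_det q threshold (cube_path vertex q \<pi>)
          = (\<Sum>j<Suc q. (- 1) ^ j * \<beta> (omit j (cube_path vertex q \<pi>)))"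
        if "\<pi> permutes {0..<q}" for \<pi>
      proof -
        have "affine_det q threshold (cube_path vertex q \<pi>) = Poly_Mapping.lookup (c (cube_path vertex q \<pi>)) e"
          using path[OF that] by (simp add: c_def)
        also have "c (cube_path vertex q \<pi>)
            = (\<Sum>j<Suc q. (- 1) ^ j * b (omit j (cube_path vertex q \<pi>)))"
          using path[OF that] False by (simp add: cb cech_diff_def del: sum.lessThan_Suc)
        finally show ?thesis
          by (simp add: lookup_sum lookup_minus_one_power \<beta>_def del: sum.lessThan_Suc)
      qed
      then have "(\<Sum>\<pi> | \<pi> permutes {0..<q}.
            of_int (sign \<pi>) * affine_det q threshold (cube_path vertex q \<pi>))
          = (\<Sum>\<pi> | \<pi> permutes {0..<q}. of_int (sign \<pi>) *
              (\<Sum>j<Suc q. (- 1) ^ j * \<beta> (omit j (cube_path vertex q \<pi>))))"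
        by (intro sum.cong[OF refl]) simp
      also have "\<dots> = 0"
        using False vanish not_full_omit_first not_full_omit_last by (intro cube_cycle) auto
      finally show ?thesis .
    qed
    with pairing_affine_det_nonzero[where 'b = 'k] show False by simp
  qed
  ultimately show ?thesis by blast
qed

end

section \<open>Numbering the cube directions increasingly within each factor\<close>

lemma prod_encode_less: "j < j' \<Longrightarrow> prod_encode (k, j) < prod_encode (k, j')"
proof -
  \<comment> \<open>The Cantor code of \<open>(k, j)\<close> is \<open>triangle (k + j) + k\<close>,
    so it suffices that the triangular numbers increase strictly.\<close>
  have "triangle m < triangle m'" if "m < m'" for m m'
    using that by (rule lift_Suc_mono_less[rotated]) simp
  then show "j < j' \<Longrightarrow> ?thesis" by (simp add: prod_encode_def)
qed

text \<open>Listing the directions by increasing Cantor code provides the order required within each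
  factor.\<close>

lemma exists_simplex_product:
  assumes "N \<subseteq> {1..r}" "\<And>k. k \<in> N \<Longrightarrow> l k \<ge> 1"
  shows "\<exists>enc. simplex_product r (\<Sum>k\<in>N. l k) l N enc"
proof -
  define E where "E = (SIGMA k:N. {1..l k})"
  have finN: "finite N" using assms(1) finite_subset by blast
  then have fin: "finite (prod_encode ` E)" by (simp add: E_def)
  have card: "card (prod_encode ` E) = (\<Sum>k\<in>N. l k)"
    using finN by (subst card_image) (auto simp: E_def inj_prod_encode)
  obtain h where h: "bij_betw h {..<card (prod_encode ` E)} (prod_encode ` E)"
    and mono: "strict_mono_on {..<card (prod_encode ` E)} h"
    using ex_bij_betw_strict_mono_card[OF fin] by blast
  have "bij_betw prod_decode (prod_encode ` E) E"
    by (rule bij_betw_imageI) (auto simp: image_image intro: inj_on_subset[OF inj_prod_decode])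
  from bij_betw_trans[OF h[unfolded card] this]
  have bij: "bij_betw (prod_decode \<circ> h) {0..<(\<Sum>k\<in>N. l k)} (SIGMA k:N. {1..l k})"
    unfolding E_def lessThan_atLeast0 .
  have "t < u" if "t < (\<Sum>k\<in>N. l k)" "u < (\<Sum>k\<in>N. l k)"
    "fst (prod_decode (h t)) = fst (prod_decode (h u))"
    "snd (prod_decode (h t)) < snd (prod_decode (h u))" for t u
  proof (rule ccontr)
    assume "\<not> t < u"
    then have "h u \<le> h t"
      using strict_mono_onD[OF mono, of u t] that(1,2) card by (cases "u = t") auto
    moreover have "h t < h u"
      using prod_encode_less[OF that(4), of "fst (prod_decode (h t))"] that(3)
      by (metis prod.collapse prod_decode_inverse)
    ultimately show False by simp
  qed
  with bij assms show ?thesis by (intro exI[of _ "prod_decode \<circ> h"]) (simp add: simplex_product_def)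
qed

section \<open>Triviality of Weyman terms\<close>

lemma coboundaries_extensional: "h \<in> coboundaries r l a q \<Longrightarrow> h \<in> extensional (tuples r l q)"
  by (auto simp: coboundaries_def cech_diff_def)

lemma mult_cech_group:
  "x \<otimes>\<^bsub>cech_group r l a q\<^esub> y = (\<lambda>\<sigma>\<in>tuples r l q. x \<sigma> + y \<sigma>)"
  by (simp add: cech_group_def section_group_simps product_group_def)

lemma zero_cochain_in_carrier: "(\<lambda>\<sigma>\<in>tuples r l q. 0) \<in> carrier (cech_group r l a q)"
  by (auto simp: cech_group_def section_group_simps zero_in_sections)

lemma cech_diff_zero: "cech_diff r l q (\<lambda>\<sigma>\<in>tuples r l q. 0) = (\<lambda>\<sigma>\<in>tuples r l (q + 1). 0)"
  unfolding cech_diff_def by (rule restrict_ext) (auto simp: omit_in_tuples intro!: sum.neutral)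

lemma zero_in_coboundaries: "(\<lambda>\<sigma>\<in>tuples r l q. 0) \<in> coboundaries r l a q"
  unfolding coboundaries_def
  using cech_diff_zero[of r l "q - 1"] zero_cochain_in_carrier[of r l "q - 1" a]
  by (metis diff_add_cancel imageI)

lemma zero_in_cocycles: "(\<lambda>\<sigma>\<in>tuples r l q. 0) \<in> cocycles r l a q"
  using zero_cochain_in_carrier[of r l q a]
  by (simp add: cocycles_def kernel_def cech_diff_zero) (simp add: cech_group_def section_group_simps)

lemma one_cohomology: "\<one>\<^bsub>cohomology r l a q\<^esub> = coboundaries r l a q"
  by (simp add: cohomology_def FactGroup_def)

lemma carrier_cohomology:
  "carrier (cohomology r l a q) =
     (\<lambda>c. (\<lambda>h. \<lambda>\<sigma>\<in>tuples r l q. h \<sigma> + c \<sigma>) ` coboundaries r l a q) ` cocycles r l a q"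
  by (auto simp: cohomology_def FactGroup_def RCOSETS_def r_coset_def mult_cech_group)

text \<open>The neutral class is the coset of the zero cochain. It fills the other coordinates when
  a class is extended to an element of a Weyman term.\<close>

lemma one_in_carrier_cohomology: "\<one>\<^bsub>cohomology r l a q\<^esub> \<in> carrier (cohomology r l a q)"
proof -
  have "(\<lambda>\<sigma>\<in>tuples r l q. h \<sigma> + (\<lambda>\<sigma>\<in>tuples r l q. 0) \<sigma>) = h" if "h \<in> coboundaries r l a q" for h
    using coboundaries_extensional[OF that] by (auto simp: extensional_def restrict_def)
  then have "(\<lambda>h. \<lambda>\<sigma>\<in>tuples r l q. h \<sigma> + (\<lambda>\<sigma>\<in>tuples r l q. 0) \<sigma>) ` coboundaries r l a q
      = coboundaries r l a q"
    by (rule trans[OF image_cong[OF refl] image_ident])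
  then show ?thesis
    unfolding one_cohomology carrier_cohomology
    by (rule image_eqI[OF sym zero_in_cocycles])
qed

text \<open>The coset of \<open>c\<close> contains \<open>0 + c\<close>, and by assumption every
  coset is the set of coboundaries.\<close>

lemma cocycle_in_coboundaries:
  fixes c :: "(nat \<Rightarrow> nat) list \<Rightarrow> 'k::field laurent"
  assumes "(carrier (cohomology r l a q) :: ((nat \<Rightarrow> nat) list \<Rightarrow> 'k laurent) set set) =
      {\<one>\<^bsub>cohomology r l a q\<^esub>}"
    and "c \<in> cocycles r l a q"
  shows "c \<in> coboundaries r l a q"
proof -
  have "c \<in> extensional (tuples r l q)"
    using assms(2) by (auto simp: cocycles_def kernel_def cech_group_def PiE_def)
  then have "c = (\<lambda>\<sigma>\<in>tuples r l q. (\<lambda>\<sigma>\<in>tuples r l q. 0) \<sigma> + c \<sigma>)"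
    by (auto simp: extensional_def restrict_def)
  then have "c \<in> (\<lambda>h. \<lambda>\<sigma>\<in>tuples r l q. h \<sigma> + c \<sigma>) ` coboundaries r l a q"
    using zero_in_coboundaries by (rule image_eqI)
  also have "(\<lambda>h. \<lambda>\<sigma>\<in>tuples r l q. h \<sigma> + c \<sigma>) ` coboundaries r l a q = coboundaries r l a q"
  proof (rule singletonD)
    show "(\<lambda>h. \<lambda>\<sigma>\<in>tuples r l q. h \<sigma> + c \<sigma>) ` coboundaries r l a q \<in> {coboundaries r l a q}"
      unfolding assms(1)[unfolded carrier_cohomology one_cohomology, symmetric]
      by (rule image_eqI[OF _ assms(2)]) (rule refl)
  qed
  finally show ?thesis .
qed

text \<open>An element of one factor, extended by neutral elements, is one of the generators of the
  sum and therefore neutral.\<close>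

lemma trivial_sum_group_factor:
  assumes "trivial_group (sum_group I G)" "i \<in> I"
    and one: "\<And>j. j \<in> I \<Longrightarrow> \<one>\<^bsub>G j\<^esub> \<in> carrier (G j)"
  shows "carrier (G i) = {\<one>\<^bsub>G i\<^esub>}"
proof -
  have "x = \<one>\<^bsub>G i\<^esub>" if "x \<in> carrier (G i)" for x
  proof -
    define y where "y = (\<lambda>j\<in>I. if j = i then x else \<one>\<^bsub>G j\<^esub>)"
    have "y \<in> (\<Pi>\<^sub>E j\<in>I. carrier (G j))"
      using one that by (auto simp: y_def)
    moreover have "finite {j \<in> I. y j \<noteq> \<one>\<^bsub>G j\<^esub>}"
      by (rule finite_subset[of _ "{i}"]) (auto simp: y_def)
    ultimately have "y \<in> carrier (sum_group I G)"
      unfolding sum_group_def carrier_subgroup_generated by (intro generate.incl) simp_all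
    then have "y = (\<lambda>j\<in>I. \<one>\<^bsub>G j\<^esub>)"
      using assms(1) unfolding trivial_group_def by (metis one_sum_group singletonD)
    from fun_cong[OF this, of i] show ?thesis
      using assms(2) by (simp add: y_def)
  qed
  with one[OF assms(2)] show ?thesis by blast
qed

text \<open>With \<open>q\<close> the sum of \<open>l\<close> over \<open>N\<close>, the nonzero
  group in degree \<open>q\<close> is a summand of the Weyman term of index \<open>p - q\<close>, so
  this index is 0 or 1.\<close>

lemma determinantal_degree:
  fixes r p :: nat and l d :: "nat \<Rightarrow> nat" and m :: "nat \<Rightarrow> int"
  defines "N \<equiv> {j \<in> {1..r}. m j - int p * int (d j) < - int (l j)}"
  assumes det: "determinantal TYPE('k::field_char_0) r l d m"
    and l: "\<And>j. j \<in> {1..r} \<Longrightarrow> l j \<ge> 1"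
    and p: "p \<le> (\<Sum>j = 1..r. l j) + 1"
    and nonneg: "\<And>j. j \<in> {1..r} - N \<Longrightarrow> 0 \<le> m j - int p * int (d j)"
  shows "(\<Sum>j\<in>N. l j) \<le> p \<and> p \<le> (\<Sum>j\<in>N. l j) + 1"
proof (rule ccontr)
  define q where "q = (\<Sum>j\<in>N. l j)"
  define a where "a = (\<lambda>j. m j - int p * int (d j))"
  assume "\<not> ((\<Sum>j\<in>N. l j) \<le> p \<and> p \<le> (\<Sum>j\<in>N. l j) + 1)"
  then have "int p - int q \<notin> {0, 1}" by (auto simp flip: q_def)
  then have "trivial_group (weyman_term r l d m (int p - int q)
      :: (nat \<times> nat \<Rightarrow> ((nat \<Rightarrow> nat) list \<Rightarrow> 'k laurent) set) monoid)"
    using det by (simp add: determinantal_def)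
  \<comment> \<open>Copy 0 of the \<open>p\<close>-th summand exists since
    \<open>p \<le> n + 1\<close> makes the binomial coefficient positive; its cohomological degree
    is \<open>p - (p - q) = q\<close>.\<close>
  from trivial_sum_group_factor[OF this[unfolded weyman_term_def Let_def], of "(p, 0)"] p
  have trivial: "carrier (cohomology r l a (int q) :: ((nat \<Rightarrow> nat) list \<Rightarrow> 'k laurent) set monoid)
      = {\<one>\<^bsub>cohomology r l a (int q)\<^esub>}"
    by (simp add: a_def one_in_carrier_cohomology case_prod_beta)
  have N: "N \<subseteq> {1..r}" by (auto simp: N_def)
  then obtain enc where "simplex_product r q l N enc"
    using exists_simplex_product[OF N, of l] l unfolding q_def by blast
  then interpret simplex_product r q l N enc .
  obtain c :: "(nat \<Rightarrow> nat) list \<Rightarrow> 'k laurent"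
    where "c \<in> cocycles r l a (int q)" "c \<notin> coboundaries r l a (int q)"
    using exists_cocycle_not_coboundary[of a, where 'k = 'k] nonneg by (auto simp: a_def N_def)
  with cocycle_in_coboundaries[OF trivial] show False by blast
qed

section \<open>Bounds for determinantal vectors\<close>

text \<open>A progression with nonzero step meets each of the \<open>u - v\<close> integers of the
  interval at most once. The offset \<open>v\<close> and a smaller \<open>u\<close> serve to cut off
  an end of the interval \<open>[-l k, -1]\<close>.\<close>

lemma card_residues_le:
  fixes x :: int and d :: nat
  assumes "d \<ge> 1"
    and "\<And>p. p \<in> P \<Longrightarrow> x - int p * int d \<in> {- int u..< - int v}" "v \<le> u"
  shows "finite P" "card P \<le> u - v"
proof -
  have inj: "inj_on (\<lambda>p. x - int p * int d) P"
    using assms(1) by (auto simp: inj_on_def)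
  have sub: "(\<lambda>p. x - int p * int d) ` P \<subseteq> {- int u..< - int v}"
    using assms(2) by blast
  show "finite P" using inj sub by (rule inj_on_finite) simp
  show "card P \<le> u - v" using card_inj_on_le[OF inj sub] assms(3) by simp
qed

lemma card_cover_le:
  assumes "finite J" "Q \<subseteq> (\<Union>j\<in>J. P j)" "\<And>j. j \<in> J \<Longrightarrow> finite (P j) \<and> card (P j) \<le> f j"
  shows "card Q \<le> (\<Sum>j\<in>J. f j :: nat)"
proof -
  have "card Q \<le> card (\<Union>j\<in>J. P j)"
    using assms by (intro card_mono) auto
  also have "\<dots> \<le> (\<Sum>j\<in>J. card (P j))" by (rule card_UN_le[OF assms(1)])
  also have "\<dots> \<le> (\<Sum>j\<in>J. f j)" using assms(3) by (intro sum_mono) blast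
  finally show ?thesis .
qed

theorem corollary3p9:
  fixes r n k :: nat and l d :: "nat \<Rightarrow> nat" and m :: "nat \<Rightarrow> int"
  assumes "r \<ge> 1"
    and "\<And>i. i \<in> {1..r} \<Longrightarrow> l i \<ge> 1"
    and "\<And>i. i \<in> {1..r} \<Longrightarrow> d i \<ge> 1"
    and "n = (\<Sum>i = 1..r. l i)"
    and "determinantal TYPE('k::{alg_closed_field, field_char_0}) r l d m"
    and "k \<in> {1..r}"
  shows "max (- int (d k)) (- int (l k)) \<le> m k \<and>
         m k \<le> int (d k) * (int n + 1) - 1 + min (int (d k) - int (l k)) 0"
proof -
  note l = assms(2) and d = assms(3) and n = assms(4) and k = assms(6)
  define a where "a = (\<lambda>j p. m j - int p * int (d j))"
  \<comment> \<open>For \<open>p\<close> in \<open>P j\<close> the twist \<open>a j p\<close> has no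
    cohomology on the \<open>j\<close>-th projective space; \<open>G\<close> collects the indices at
    which no factor is acyclic.\<close>
  define P where "P = (\<lambda>j. {p. p \<le> n + 1 \<and> a j p \<in> {- int (l j)..< 0}})"
  define G where "G = {p. p \<le> n + 1 \<and> (\<forall>j\<in>{1..r}. p \<notin> P j)}"
  define N where "N = (\<lambda>p. {j \<in> {1..r}. a j p < - int (l j)})"
  have a_antimono: "a j p' \<le> a j p" if "p \<le> p'" for j p p'
    using that by (simp add: a_def mult_right_mono)
  have P: "finite (P j) \<and> card (P j) \<le> l j" if "j \<in> {1..r}" for j
    using card_residues_le[of "d j" "P j" "m j" "l j" 0] d[OF that] by (simp add: P_def a_def)
  have sign: "j \<in> N p \<or> 0 \<le> a j p" if "p \<in> G" "j \<in> {1..r}" for p j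
    using that by (force simp: G_def P_def N_def)
  have degree: "(\<Sum>j\<in>N p. l j) \<le> p \<and> p \<le> (\<Sum>j\<in>N p. l j) + 1" if "p \<in> G" for p
    using determinantal_degree[OF assms(5), of p] l sign[OF that] that n
    by (force simp: N_def a_def G_def)
  \<comment> \<open>There are \<open>n + 2\<close> indices, of which at most \<open>n\<close> are
    excluded.\<close>
  have "G \<noteq> {}"
  proof
    assume "G = {}"
    then have "{0..n + 1} \<subseteq> (\<Union>j\<in>{1..r}. P j)" by (auto simp: G_def)
    then have "card {0..n + 1} \<le> n"
      unfolding n using P by (intro card_cover_le) auto
    then show False by simp
  qed
  have finG: "finite G" by (simp add: G_def)
  text \<open>If a bound fails, the forbidden interval of \<open>k\<close> contains fewer than \<open>l k\<close> of the
    indices \<open>0, \<dots>, n + 1\<close>, which makes the count below strict.\<close>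
  have strict: "(\<Sum>j\<in>J. if j = k then l k - 1 else l j) < (\<Sum>j\<in>J. l j)"
    if "finite J" "k \<in> J" for J
    using that l[OF k] by (intro sum_strict_mono_ex1) auto
  have "max (- int (d k)) (- int (l k)) \<le> m k"
  proof (rule ccontr)
    assume low: "\<not> max (- int (d k)) (- int (l k)) \<le> m k"
    have le: "a k p \<le> m k" for p
      using a_antimono[of 0 p k] by (simp add: a_def)
    \<comment> \<open>If \<open>m k < - l k\<close>, then \<open>P k\<close> is empty; if
      \<open>m k < - d k\<close>, all values stay below \<open>-1\<close>. Either way
      \<open>-1\<close> is not attained.\<close>
    have "a k p \<in> {- int (l k)..<- int 1}" if "p \<in> P k" for p
      using low that le[of p] d[OF k] by (auto simp: P_def)
    then have Pk: "card (P k) \<le> l k - 1"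
      using d[OF k] l[OF k] card_residues_le[of "d k" "P k" "m k" "l k" 1] by (simp add: a_def)
    define p where "p = Min G"
    have p: "p \<in> G" unfolding p_def using finG \<open>G \<noteq> {}\<close> by (rule Min_in)
    have "{0..<p} \<subseteq> (\<Union>j\<in>N p. P j)"
    proof
      fix p' assume p': "p' \<in> {0..<p}"
      then have "p' \<notin> G" unfolding p_def using finG by (auto dest: Min_le)
      then obtain j where j: "j \<in> {1..r}" "p' \<in> P j"
        using p p' by (auto simp: G_def)
      \<comment> \<open>Since \<open>p\<close> is admissible, a negative \<open>a j p\<close> lies
        below \<open>- l j\<close>, which places \<open>j\<close> in \<open>N p\<close>.\<close>
      then have "a j p < 0" using a_antimono[of p' p j] p' by (auto simp: P_def)
      then show "p' \<in> (\<Union>j\<in>N p. P j)" using sign[OF p j(1)] j by auto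
    qed
    then have "card {0..<p} \<le> (\<Sum>j\<in>N p. if j = k then l k - 1 else l j)"
      using P Pk by (intro card_cover_le) (auto simp: N_def)
    also have "\<dots> < (\<Sum>j\<in>N p. l j)"
    proof (rule strict)
      have "a k p < 0" using low le[of p] by auto
      then show "k \<in> N p" using sign[OF p k] by auto
    qed (simp add: N_def)
    finally show False using degree[OF p] by simp
  qed
  moreover have "m k \<le> int (d k) * (int n + 1) - 1 + min (int (d k) - int (l k)) 0"
  proof (rule ccontr)
    assume high: "\<not> m k \<le> int (d k) * (int n + 1) - 1 + min (int (d k) - int (l k)) 0"
    \<comment> \<open>Failure of the bound is the inequality at \<open>p = n + 1\<close>, where
      \<open>a k\<close> is smallest.\<close>
    have ge: "min (int (d k) - int (l k)) 0 \<le> a k p" if "p \<le> n + 1" for p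
      using high a_antimono[OF that, of k] by (simp add: a_def algebra_simps)
    define p where "p = Max G"
    have p: "p \<in> G" unfolding p_def using finG \<open>G \<noteq> {}\<close> by (rule Max_in)
    define J where "J = {1..r} - N p"
    \<comment> \<open>As \<open>d k\<close> and \<open>l k\<close> are at least 1, the minimum in
      \<open>ge\<close> exceeds \<open>- l k\<close>, so here the lower end of the interval is not
      attained.\<close>
    have "a k p' \<in> {- int (l k - 1)..<0}" if "p' \<in> P k" for p'
      using ge[of p'] that d[OF k] l[OF k] by (auto simp: P_def)
    then have Pk: "card (P k) \<le> l k - 1"
      using d[OF k] card_residues_le[of "d k" "P k" "m k" "l k - 1" 0] by (simp add: a_def)
    have "{p<..n + 1} \<subseteq> (\<Union>j\<in>J. P j)"
    proof
      fix p' assume p': "p' \<in> {p<..n + 1}"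
      then have "p' \<notin> G" unfolding p_def using finG by (auto dest: Max_ge)
      then obtain j where j: "j \<in> {1..r}" "p' \<in> P j"
        using p' by (auto simp: G_def)
      then have "- int (l j) \<le> a j p" using a_antimono[of p p' j] p' by (auto simp: P_def)
      then show "p' \<in> (\<Union>j\<in>J. P j)" using j by (auto simp: J_def N_def)
    qed
    then have "card {p<..n + 1} \<le> (\<Sum>j\<in>J. if j = k then l k - 1 else l j)"
      using P Pk by (intro card_cover_le) (auto simp: J_def)
    also have "\<dots> < (\<Sum>j\<in>J. l j)"
    proof (rule strict)
      have "- int (l k) \<le> a k p" using ge[of p] p by (auto simp: G_def)
      then show "k \<in> J" using k by (auto simp: J_def N_def)
    qed (simp add: J_def)
    \<comment> \<open>The sum over \<open>J\<close> is \<open>n\<close> minus the sum over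
      \<open>N p\<close>, so \<open>p\<close> exceeds the latter by more than 1, against
      \<open>degree\<close>.\<close>
    finally have "n + 1 - p < (\<Sum>j\<in>J. l j)" by simp
    moreover have "(\<Sum>j\<in>J. l j) + (\<Sum>j\<in>N p. l j) = n"
      unfolding n J_def by (rule sum.subset_diff[symmetric]) (auto simp: N_def)
    ultimately show False using degree[OF p] p by (auto simp: G_def)
  qed
  ultimately show ?thesis by blast
qed

end
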